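(* There exists an aperiodic sample-continuous centered Gaussian process $\{X(t),0\le t\le 1\}$ such that $$\lim_{\varepsilon\to0}\frac{\log N([0,1],d_X,\varepsilon)}{\log\frac1\varepsilon}=\infty \qquad\text{whereas}\qquad \liminf_{\varepsilon\to0}\frac{\log\mathbb{P}\big\{\sup_{0\le t\le1}|X(t)|\le\varepsilon\big\}}{(\log\frac1\varepsilon)^2}>-\infty .$$
   Context: For a centered Gaussian process $X$, $d_X(s,t)=\|X(s)-X(t)\|_2=(\mathbb{E}|X(s)-X(t)|^2)^{1/2}$. The entropy number $N(T,d,\varepsilon)$ is the minimal number of $d$-balls of radius $\varepsilon>0$ enough to cover $T$. Aperiodic means not periodic in the time parameter $t$. *)

theory Defs
  imports "HOL-Probability.Probability"
begin

text \<open>Gaussian laws may be degenerate: a constant is a Gaussian variable of variance 0, for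
  which there is no density. The disjunction is needed because \<^const>\<open>normal_density\<close> is the
  density of a probability law only for a positive standard deviation.\<close>

definition gaussian_variable :: "'a measure \<Rightarrow> ('a \<Rightarrow> real) \<Rightarrow> bool" where
  "gaussian_variable M Y \<longleftrightarrow> Y \<in> borel_measurable M \<and>
     ((\<exists>\<mu> \<sigma>. 0 < \<sigma> \<and> distributed M lborel Y (normal_density \<mu> \<sigma>)) \<or>
      (\<exists>\<mu>. AE \<omega> in M. Y \<omega> = \<mu>))"

definition gaussian_process :: "'a measure \<Rightarrow> 't set \<Rightarrow> ('t \<Rightarrow> 'a \<Rightarrow> real) \<Rightarrow> bool" where
  "gaussian_process M T X \<longleftrightarrow>
     (\<forall>F c. finite F \<and> F \<subseteq> T \<longrightarrow> gaussian_variable M (\<lambda>\<omega>. \<Sum>t\<in>F. c t * X t \<omega>))"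

definition centered_gaussian_process :: "'a measure \<Rightarrow> 't set \<Rightarrow> ('t \<Rightarrow> 'a \<Rightarrow> real) \<Rightarrow> bool" where
  "centered_gaussian_process M T X \<longleftrightarrow>
     gaussian_process M T X \<and> (\<forall>t\<in>T. (\<integral>\<omega>. X t \<omega> \<partial>M) = 0)"

definition sample_continuous ::
  "'a measure \<Rightarrow> 't::topological_space set \<Rightarrow> ('t \<Rightarrow> 'a \<Rightarrow> real) \<Rightarrow> bool" where
  "sample_continuous M T X \<longleftrightarrow> (\<forall>\<omega>\<in>space M. continuous_on T (\<lambda>t. X t \<omega>))"

text \<open>Periodicity on a time set \<open>T\<close> that need not be invariant under translation: some \<open>p > 0\<close>,
  realised as a difference of two times, satisfies \<open>X (t + p) = X t\<close> almost surely whenever both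
  times lie in \<open>T\<close>. Without the nonemptiness clause every process on \<open>{0..1}\<close> would vacuously
  have every period \<open>p > 1\<close>. On \<open>{0..1}\<close> the period \<open>p = 1\<close> is admitted, so the
  restriction to \<open>{0..1}\<close> of a process of period 1 on the line counts as periodic.\<close>

definition periodic_process :: "'a measure \<Rightarrow> real set \<Rightarrow> (real \<Rightarrow> 'a \<Rightarrow> real) \<Rightarrow> bool" where
  "periodic_process M T X \<longleftrightarrow>
     (\<exists>p>0. (\<exists>t\<in>T. t + p \<in> T) \<and>
        (\<forall>t\<in>T. t + p \<in> T \<longrightarrow> (AE \<omega> in M. X (t + p) \<omega> = X t \<omega>)))"

definition process_dist :: "'a measure \<Rightarrow> ('t \<Rightarrow> 'a \<Rightarrow> real) \<Rightarrow> 't \<Rightarrow> 't \<Rightarrow> real" where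
  "process_dist M X s t = sqrt (\<integral>\<omega>. \<bar>X s \<omega> - X t \<omega>\<bar>\<^sup>2 \<partial>M)"

text \<open>The balls are open, with centres in \<open>T\<close>; the value is \<open>\<infinity>\<close> if there is no finite cover.\<close>

definition entropy_number :: "'t set \<Rightarrow> ('t \<Rightarrow> 't \<Rightarrow> real) \<Rightarrow> real \<Rightarrow> enat" where
  "entropy_number T d \<epsilon> =
     (INF C\<in>{C. finite C \<and> C \<subseteq> T \<and> T \<subseteq> (\<Union>c\<in>C. {t. d c t < \<epsilon>})}. enat (card C))"

text \<open>The real \<^const>\<open>ln\<close> has \<open>ln 0 = 0\<close>, which would make a lower bound on the logarithm of
  a small ball probability trivial if that probability vanished.\<close>

definition eln :: "ennreal \<Rightarrow> ereal" where
  "eln x = (if x = 0 then -\<infinity> else if x = \<infinity> then \<infinity> else ereal (ln (enn2real x)))"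

end

theory Submission
  imports Defs
begin

text \<open>The process is \<open>X t = (\<Sum>n. g\<^sub>n * cos (n! * t) / 4 ^ n)\<close> with independent standard normal
  \<open>g\<^sub>n\<close>. As \<open>n!\<close> grows superexponentially, finitely many of the phases \<open>n! * t\<close>, \<open>n \<ge> k\<^sub>0\<close>, can be
  prescribed independently up to a small error, so \<open>q\<close> values in each of about \<open>log\<^sub>4 (1/\<epsilon>)\<close>
  coordinates give \<open>(1/\<epsilon>) powr (log\<^sub>4 q)\<close> separated times up to a constant, for every \<open>q\<close>.
  The small ball event contains the box \<open>\<bar>g\<^sub>n\<bar> \<le> \<epsilon> / 2 * 2 ^ n\<close> for all \<open>n\<close>, in which only about
  \<open>log\<^sub>2 (1/\<epsilon>)\<close> coordinates are restricted to a small set, each at a cost of order \<open>\<epsilon>\<close>.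
  The term \<open>n = 0\<close> excludes every period, since \<open>cos\<close> is injective on \<open>[0, 1]\<close>.\<close>

section \<open>Gaussian series\<close>

definition normal_seq :: "(nat \<Rightarrow> real) measure" where
  "normal_seq = (\<Pi>\<^sub>M n\<in>UNIV. std_normal_distribution)"

interpretation std_normal: real_distribution std_normal_distribution
  by (rule real_dist_normal_dist)

interpretation std_normals: product_prob_space "\<lambda>n::nat. std_normal_distribution" UNIV
  by unfold_locales

lemma prob_space_normal_seq: "prob_space normal_seq"
  unfolding normal_seq_def by unfold_locales

interpretation normal_seq: prob_space normal_seq
  by (rule prob_space_normal_seq)

lemma space_normal_seq [simp]: "space normal_seq = UNIV"
  by (simp add: normal_seq_def space_PiM)

lemma measurable_normal_seq_component [measurable]: "(\<lambda>\<omega>. \<omega> n) \<in> borel_measurable normal_seq"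
proof -
  have "(\<lambda>\<omega>. \<omega> n) \<in> measurable (\<Pi>\<^sub>M n\<in>UNIV. std_normal_distribution) std_normal_distribution"
    by (rule measurable_component_singleton) simp
  then show ?thesis
    by (simp add: normal_seq_def cong: measurable_cong_sets)
qed

lemma distr_normal_seq_component: "distr normal_seq borel (\<lambda>\<omega>. \<omega> n) = std_normal_distribution"
proof -
  have "distr normal_seq borel (\<lambda>\<omega>. \<omega> n) = distr normal_seq std_normal_distribution (\<lambda>\<omega>. \<omega> n)"
    by (rule distr_cong) auto
  also have "\<dots> = std_normal_distribution"
    unfolding normal_seq_def by (rule std_normals.PiM_component) simp
  finally show ?thesis .
qed

text \<open>On the canonical product space the joint law of the coordinates is by construction the
  product of the marginals, which is independence; scaling each coordinate by a constant preserves
  it.\<close>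

lemma indep_vars_normal_seq: "normal_seq.indep_vars (\<lambda>_. borel) (\<lambda>n \<omega>. c n * \<omega> n) UNIV"
proof -
  have "normal_seq.indep_vars (\<lambda>_. std_normal_distribution) (\<lambda>n \<omega>. \<omega> n) UNIV"
  proof (subst normal_seq.indep_vars_iff_distr_eq_PiM')
    show "distr normal_seq (\<Pi>\<^sub>M i\<in>UNIV. std_normal_distribution) (\<lambda>x. \<lambda>i\<in>UNIV. x i) =
      (\<Pi>\<^sub>M i\<in>UNIV. distr normal_seq std_normal_distribution (\<lambda>\<omega>. \<omega> i))"
      unfolding normal_seq_def
      by (subst std_normals.PiM_component) (auto simp: restrict_UNIV distr_id2)
  qed auto
  then show ?thesis
    by (rule normal_seq.indep_vars_compose2) simp
qed

lemma char_normal_seq_component: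
  "char (distr normal_seq borel (\<lambda>\<omega>. c * \<omega> n)) t = complex_of_real (exp (- (t * c)\<^sup>2 / 2))"
proof -
  have "char (distr normal_seq borel (\<lambda>\<omega>. c * \<omega> n)) t
      = char (distr (distr normal_seq borel (\<lambda>\<omega>. \<omega> n)) borel (\<lambda>x. c * x)) t"
    by (subst distr_distr) (auto simp: comp_def)
  also have "\<dots> = char std_normal_distribution (t * c)"
    unfolding distr_normal_seq_component
    by (simp add: char_def integral_distr mult.assoc)
  finally show ?thesis
    by (simp add: char_std_normal_distribution)
qed

text \<open>Independence turns the characteristic function of the sum into a product of Gaussian
  exponentials, so the variances \<open>(b n)\<^sup>2\<close> add up in the exponent.\<close>

lemma char_normal_seq_sum:
  "char (distr normal_seq borel (\<lambda>\<omega>. \<Sum>n<N. b n * \<omega> n)) t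
    = complex_of_real (exp (- t\<^sup>2 * (\<Sum>n<N. (b n)\<^sup>2) / 2))"
proof -
  have "char (distr normal_seq borel (\<lambda>\<omega>. \<Sum>n<N. b n * \<omega> n)) t
      = (\<Prod>n<N. char (distr normal_seq borel (\<lambda>\<omega>. b n * \<omega> n)) t)"
    by (intro normal_seq.char_distr_sum normal_seq.indep_vars_subset[OF indep_vars_normal_seq]) auto
  also have "\<dots> = complex_of_real (exp (\<Sum>n<N. - (t * b n)\<^sup>2 / 2))"
    by (simp add: char_normal_seq_component exp_sum)
  also have "(\<Sum>n<N. - (t * b n)\<^sup>2 / 2) = - t\<^sup>2 * (\<Sum>n<N. (b n)\<^sup>2) / 2"
    by (simp add: sum_distrib_left sum_divide_distrib power_mult_distrib)
  finally show ?thesis .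
qed

text \<open>The condition does not mention the coefficients: a single exceptional null set serves
  all coefficient sequences of order \<open>1 / 4 ^ n\<close>, hence all times \<open>t\<close> at
  once.\<close>

definition good_seq :: "(nat \<Rightarrow> real) \<Rightarrow> bool" where
  "good_seq \<omega> \<longleftrightarrow> summable (\<lambda>n. \<bar>\<omega> n\<bar> / 4 ^ n)"

lemma measurable_good_seq [measurable]: "Measurable.pred normal_seq good_seq"
proof -
  \<comment> \<open>Summability of nonnegative terms is finiteness of an \<open>ennreal\<close>
    series, which is visibly measurable.\<close>
  have eq: "good_seq = (\<lambda>\<omega>. (\<Sum>n. ennreal (\<bar>\<omega> n\<bar> / 4 ^ n)) \<noteq> \<infinity>)"
  proof (intro ext iffI)
    fix \<omega>
    assume "good_seq \<omega>"
    then have "(\<Sum>n. ennreal (\<bar>\<omega> n\<bar> / 4 ^ n)) = ennreal (\<Sum>n. \<bar>\<omega> n\<bar> / 4 ^ n)"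
      unfolding good_seq_def by (intro suminf_ennreal2) simp_all
    then show "(\<Sum>n. ennreal (\<bar>\<omega> n\<bar> / 4 ^ n)) \<noteq> \<infinity>"
      by (simp only: infinity_ennreal_def ennreal_neq_top not_False_eq_True)
  next
    fix \<omega>
    assume "(\<Sum>n. ennreal (\<bar>\<omega> n\<bar> / 4 ^ n)) \<noteq> \<infinity>"
    then show "good_seq \<omega>"
      unfolding good_seq_def infinity_ennreal_def by (intro summable_suminf_not_top) simp_all
  qed
  have "Measurable.pred normal_seq (\<lambda>\<omega>. (\<Sum>n. ennreal (\<bar>\<omega> n\<bar> / 4 ^ n)) \<noteq> \<infinity>)"
    by measurable
  then show ?thesis
    by (simp only: eq)
qed

text \<open>The expectation of the series is a geometric series times the first absolute moment
  \<open>C\<close>, hence finite, and a nonnegative variable with finite expectation is almost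
  surely finite.\<close>

lemma AE_good_seq: "AE \<omega> in normal_seq. good_seq \<omega>"
proof -
  define C where "C = (\<integral>x. \<bar>x\<bar> \<partial>std_normal_distribution)"
  have int: "integrable std_normal_distribution (\<lambda>x. \<bar>x\<bar>)"
    using integrable_std_normal_distribution_moment[of 1] by simp
  have C: "(\<integral>\<^sup>+\<omega>. ennreal \<bar>\<omega> n\<bar> \<partial>normal_seq) = ennreal C" for n
  proof -
    have "(\<integral>\<^sup>+\<omega>. ennreal \<bar>\<omega> n\<bar> \<partial>normal_seq) = (\<integral>\<^sup>+x. ennreal \<bar>x\<bar> \<partial>distr normal_seq borel (\<lambda>\<omega>. \<omega> n))"
      by (subst nn_integral_distr) auto
    also have "\<dots> = ennreal C"
      unfolding distr_normal_seq_component C_def using int by (intro nn_integral_eq_integral) auto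
    finally show ?thesis .
  qed
  have "(\<integral>\<^sup>+\<omega>. (\<Sum>n. ennreal (\<bar>\<omega> n\<bar> / 4 ^ n)) \<partial>normal_seq)
      = (\<Sum>n. \<integral>\<^sup>+\<omega>. ennreal (\<bar>\<omega> n\<bar> / 4 ^ n) \<partial>normal_seq)"
    by (rule nn_integral_suminf) measurable
  also have "\<dots> = (\<Sum>n. ennreal (C * (1 / 4) ^ n))"
  proof (intro suminf_cong)
    fix n
    have "(\<integral>\<^sup>+\<omega>. ennreal (\<bar>\<omega> n\<bar> / 4 ^ n) \<partial>normal_seq)
        = (\<integral>\<^sup>+\<omega>. ennreal ((1 / 4) ^ n) * ennreal \<bar>\<omega> n\<bar> \<partial>normal_seq)"
      by (simp add: ennreal_mult'[symmetric] power_one_over field_simps)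
    also have "\<dots> = ennreal ((1 / 4) ^ n) * ennreal C"
      by (simp add: nn_integral_cmult C)
    also have "\<dots> = ennreal (C * (1 / 4) ^ n)"
      by (subst mult.commute, subst ennreal_mult'') simp_all
    finally show "(\<integral>\<^sup>+\<omega>. ennreal (\<bar>\<omega> n\<bar> / 4 ^ n) \<partial>normal_seq) = ennreal (C * (1 / 4) ^ n)" .
  qed
  also have "\<dots> \<noteq> \<infinity>"
  proof -
    have "0 \<le> C" by (simp add: C_def)
    moreover have "summable (\<lambda>n. C * (1 / 4) ^ n)"
      by (intro summable_mult summable_geometric) simp
    ultimately show ?thesis
      by (subst suminf_ennreal2) auto
  qed
  finally have "AE \<omega> in normal_seq. (\<Sum>n. ennreal (\<bar>\<omega> n\<bar> / 4 ^ n)) \<noteq> \<infinity>"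
    by (intro nn_integral_PInf_AE) auto
  then show ?thesis
    by eventually_elim (auto simp: good_seq_def intro!: summable_suminf_not_top)
qed

text \<open>The value 0 on the null set of divergence makes every path continuous.\<close>

definition gauss_series :: "(nat \<Rightarrow> real) \<Rightarrow> (nat \<Rightarrow> real) \<Rightarrow> real" where
  "gauss_series b \<omega> = (if good_seq \<omega> then \<Sum>n. b n * \<omega> n else 0)"

lemma measurable_gauss_series [measurable]: "gauss_series b \<in> borel_measurable normal_seq"
  unfolding gauss_series_def[abs_def] by measurable

section \<open>Laws and moments of Gaussian series\<close>

lemma good_seq_summable:
  assumes "good_seq \<omega>" "\<And>n. \<bar>b n\<bar> \<le> C / 4 ^ n"
  shows "summable (\<lambda>n. b n * \<omega> n)"
proof (rule summable_comparison_test')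
  show "summable (\<lambda>n. C * (\<bar>\<omega> n\<bar> / 4 ^ n))"
    using assms(1) unfolding good_seq_def by (rule summable_mult)
  show "norm (b n * \<omega> n) \<le> C * (\<bar>\<omega> n\<bar> / 4 ^ n)" for n
    using mult_right_mono[OF assms(2)[of n], of "\<bar>\<omega> n\<bar>"] by (simp add: abs_mult)
qed

lemma summable_square_coeff:
  fixes b :: "nat \<Rightarrow> real"
  assumes "\<And>n. \<bar>b n\<bar> \<le> C / 4 ^ n"
  shows "summable (\<lambda>n. (b n)\<^sup>2)"
proof (rule summable_comparison_test')
  show "summable (\<lambda>n. C\<^sup>2 * (1 / 16) ^ n)"
    by (intro summable_mult summable_geometric) simp
  fix n
  have "\<bar>b n\<bar>\<^sup>2 \<le> (C / 4 ^ n)\<^sup>2"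
    using assms by (intro power_mono) auto
  also have "\<dots> = C\<^sup>2 * (1 / 16) ^ n"
    by (simp add: power_divide power_one_over power2_eq_square power_mult_distrib[symmetric])
  finally show "norm ((b n)\<^sup>2) \<le> C\<^sup>2 * (1 / 16) ^ n" by simp
qed

text \<open>The characteristic functions of the partial sums are explicit and converge, and Levy's
  uniqueness theorem identifies the limit law. Comparing with a scaled copy of one coordinate,
  rather than with a density, covers variance 0 as well.\<close>

lemma distr_gauss_series:
  assumes b: "\<And>n. \<bar>b n\<bar> \<le> C / 4 ^ n"
  shows "distr normal_seq borel (gauss_series b)
    = distr normal_seq borel (\<lambda>\<omega>. sqrt (\<Sum>n. (b n)\<^sup>2) * \<omega> 0)"
proof (rule Levy_uniqueness)
  let ?\<sigma> = "sqrt (\<Sum>n. (b n)\<^sup>2)"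
  show "char (distr normal_seq borel (gauss_series b)) = char (distr normal_seq borel (\<lambda>\<omega>. ?\<sigma> * \<omega> 0))"
  proof
    fix t
    let ?S = "\<lambda>N \<omega>. \<Sum>n<N. b n * \<omega> n"
    \<comment> \<open>The integrands have modulus 1, so almost sure convergence of the partial sums
      suffices.\<close>
    have "(\<lambda>N. CLINT \<omega>|normal_seq. iexp (t * ?S N \<omega>)) \<longlonglongrightarrow> (CLINT \<omega>|normal_seq. iexp (t * gauss_series b \<omega>))"
    proof (rule integral_dominated_convergence[where w="\<lambda>_. 1"])
      show "AE \<omega> in normal_seq. (\<lambda>N. iexp (t * ?S N \<omega>)) \<longlonglongrightarrow> iexp (t * gauss_series b \<omega>)"
        using AE_good_seq
      proof eventually_elim
        case (elim \<omega>)
        then have "(\<lambda>N. ?S N \<omega>) \<longlonglongrightarrow> gauss_series b \<omega>"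
          using summable_LIMSEQ[OF good_seq_summable[OF elim b]] by (simp add: gauss_series_def)
        then show ?case
          by (intro tendsto_intros)
      qed
    qed auto
    then have "(\<lambda>N. char (distr normal_seq borel (?S N)) t) \<longlonglongrightarrow> char (distr normal_seq borel (gauss_series b)) t"
      by (simp add: char_def integral_distr)
    moreover have "(\<lambda>N. char (distr normal_seq borel (?S N)) t) \<longlonglongrightarrow> complex_of_real (exp (- t\<^sup>2 * (\<Sum>n. (b n)\<^sup>2) / 2))"
      unfolding char_normal_seq_sum
      by (intro tendsto_intros summable_LIMSEQ summable_square_coeff[OF b]) simp
    ultimately have "char (distr normal_seq borel (gauss_series b)) t = complex_of_real (exp (- t\<^sup>2 * (\<Sum>n. (b n)\<^sup>2) / 2))"
      by (rule LIMSEQ_unique)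
    also have "\<dots> = char (distr normal_seq borel (\<lambda>\<omega>. ?\<sigma> * \<omega> 0)) t"
      using suminf_nonneg[OF summable_square_coeff[OF b]]
      by (simp add: char_normal_seq_component power_mult_distrib)
    finally show "char (distr normal_seq borel (gauss_series b)) t = char (distr normal_seq borel (\<lambda>\<omega>. ?\<sigma> * \<omega> 0)) t" .
  qed
qed (auto intro!: normal_seq.real_distribution_distr)

lemma distributed_gauss_series:
  assumes b: "\<And>n. \<bar>b n\<bar> \<le> C / 4 ^ n" and pos: "0 < (\<Sum>n. (b n)\<^sup>2)"
  shows "distributed normal_seq lborel (gauss_series b) (normal_density 0 (sqrt (\<Sum>n. (b n)\<^sup>2)))"
proof -
  let ?\<sigma> = "sqrt (\<Sum>n. (b n)\<^sup>2)"
  have "distributed normal_seq lborel (\<lambda>\<omega>. \<omega> 0) std_normal_density"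
    using distr_normal_seq_component[of 0]
    by (auto simp: distributed_def cong: distr_cong)
  then have "distributed normal_seq lborel (\<lambda>\<omega>. 0 + ?\<sigma> * \<omega> 0) (normal_density (0 + ?\<sigma> * 0) (\<bar>?\<sigma>\<bar> * 1))"
    using pos by (intro normal_seq.normal_density_affine) auto
  then have "distr normal_seq lborel (\<lambda>\<omega>. ?\<sigma> * \<omega> 0) = density lborel (normal_density 0 ?\<sigma>)"
    using pos by (simp add: distributed_def)
  \<comment> \<open>\<open>distributed\<close> is stated over \<open>lborel\<close>, the identity of
    laws over \<open>borel\<close>; both have the same measurable sets.\<close>
  moreover have "distr normal_seq lborel f = distr normal_seq borel f" for f :: "_ \<Rightarrow> real"
    by (rule distr_cong) auto
  ultimately show ?thesis
    using distr_gauss_series[OF b] by (simp add: distributed_def)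
qed

lemma gaussian_variable_gauss_series:
  assumes b: "\<And>n. \<bar>b n\<bar> \<le> C / 4 ^ n"
  shows "gaussian_variable normal_seq (gauss_series b)"
proof (cases "(\<Sum>n. (b n)\<^sup>2) = 0")
  case True
  \<comment> \<open>Variance 0 forces all coefficients to vanish, so the series is constantly 0 and
    falls under the degenerate case of \<open>gaussian_variable\<close>.\<close>
  then have "b n = 0" for n
    using suminf_eq_zero_iff[OF summable_square_coeff[OF b]] by simp
  then show ?thesis
    by (auto simp: gaussian_variable_def gauss_series_def)
next
  case False
  with suminf_nonneg[OF summable_square_coeff[OF b]] have "0 < (\<Sum>n. (b n)\<^sup>2)"
    by auto
  then have "0 < sqrt (\<Sum>n. (b n)\<^sup>2) \<and>
      distributed normal_seq lborel (gauss_series b) (normal_density 0 (sqrt (\<Sum>n. (b n)\<^sup>2)))"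
    using distributed_gauss_series[OF b] by simp
  then show ?thesis
    unfolding gaussian_variable_def using measurable_gauss_series by blast
qed

lemma integral_gauss_series:
  assumes b: "\<And>n. \<bar>b n\<bar> \<le> C / 4 ^ n" and [measurable]: "f \<in> borel_measurable borel"
  shows "(\<integral>\<omega>. f (gauss_series b \<omega>) \<partial>normal_seq)
    = (\<integral>x. f (sqrt (\<Sum>n. (b n)\<^sup>2) * x :: real) \<partial>std_normal_distribution :: real)"
proof -
  have "(\<integral>\<omega>. f (gauss_series b \<omega>) \<partial>normal_seq) = (\<integral>x. f x \<partial>distr normal_seq borel (gauss_series b))"
    by (simp add: integral_distr)
  also have "\<dots> = (\<integral>\<omega>. f (sqrt (\<Sum>n. (b n)\<^sup>2) * \<omega> 0) \<partial>normal_seq)"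
    unfolding distr_gauss_series[OF b] by (simp add: integral_distr)
  also have "\<dots> = (\<integral>x. f (sqrt (\<Sum>n. (b n)\<^sup>2) * x) \<partial>distr normal_seq borel (\<lambda>\<omega>. \<omega> 0))"
    by (simp add: integral_distr)
  finally show ?thesis
    unfolding distr_normal_seq_component .
qed

lemma expectation_gauss_series:
  assumes "\<And>n. \<bar>b n\<bar> \<le> C / 4 ^ n"
  shows "(\<integral>\<omega>. gauss_series b \<omega> \<partial>normal_seq) = 0"
  using integral_gauss_series[OF assms, of "\<lambda>x. x"] integral_std_normal_distribution_moment_odd[of 1]
  by simp

lemma second_moment_gauss_series:
  assumes "\<And>n. \<bar>b n\<bar> \<le> C / 4 ^ n"
  shows "(\<integral>\<omega>. (gauss_series b \<omega>)\<^sup>2 \<partial>normal_seq) = (\<Sum>n. (b n)\<^sup>2)"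
  using integral_gauss_series[OF assms, of "\<lambda>x. x\<^sup>2"] std_normal_distribution_even_moments(1)[of 1]
    suminf_nonneg[OF summable_square_coeff[OF assms]]
  by (simp add: power_mult_distrib)

text \<open>Linearity holds at every \<open>\<omega>\<close>, not only almost surely: on good
  sequences by convergence, elsewhere because both sides are 0. It makes every linear combination of
  values of the process a Gaussian series again.\<close>

lemma gauss_series_sum:
  assumes "\<And>t n. t \<in> F \<Longrightarrow> \<bar>b t n\<bar> \<le> C / 4 ^ n"
  shows "(\<Sum>t\<in>F. c t * gauss_series (b t) \<omega>) = gauss_series (\<lambda>n. \<Sum>t\<in>F. c t * b t n) \<omega>"
proof (cases "good_seq \<omega>")
  case True
  have summable: "summable (\<lambda>n. b t n * \<omega> n)" if "t \<in> F" for t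
    using good_seq_summable[OF True assms[OF that]] .
  have "(\<Sum>t\<in>F. c t * (\<Sum>n. b t n * \<omega> n)) = (\<Sum>t\<in>F. \<Sum>n. c t * (b t n * \<omega> n))"
    by (intro sum.cong refl suminf_mult[symmetric] summable)
  also have "\<dots> = (\<Sum>n. \<Sum>t\<in>F. c t * (b t n * \<omega> n))"
    by (intro suminf_sum[symmetric] summable_mult summable)
  finally show ?thesis
    using True by (simp add: gauss_series_def sum_distrib_right mult.assoc)
qed (simp add: gauss_series_def)

lemma gauss_series_diff:
  assumes "\<And>n. \<bar>b n\<bar> \<le> C / 4 ^ n" "\<And>n. \<bar>b' n\<bar> \<le> C / 4 ^ n"
  shows "gauss_series b \<omega> - gauss_series b' \<omega> = gauss_series (\<lambda>n. b n - b' n) \<omega>"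
  using suminf_diff[OF good_seq_summable[OF _ assms(1)] good_seq_summable[OF _ assms(2)], of \<omega> \<omega>]
  by (simp add: gauss_series_def left_diff_distrib)

text \<open>The growth rate 2 of the box lies strictly between 1 and 4: against the decay
  \<open>1 / 4 ^ n\<close> the terms still sum to \<open>\<epsilon>\<close>, while the sides of the
  box widen fast enough that the late coordinates cost almost no probability.\<close>

lemma abs_gauss_series_le:
  assumes b: "\<And>n. \<bar>b n\<bar> \<le> 1 / 4 ^ n" and \<omega>: "\<And>n. \<bar>\<omega> n\<bar> \<le> \<epsilon> / 2 * 2 ^ n"
  shows "\<bar>gauss_series b \<omega>\<bar> \<le> \<epsilon>"
proof -
  have geom: "(\<lambda>n. \<epsilon> / 2 * (1 / 2) ^ n) sums \<epsilon>"
    using sums_mult[OF geometric_sums[of "1 / 2 :: real"], of "\<epsilon> / 2"] by simp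
  have "\<bar>b n * \<omega> n\<bar> \<le> \<epsilon> / 2 * (1 / 2) ^ n" for n
  proof -
    have "\<bar>b n * \<omega> n\<bar> \<le> (1 / 4 ^ n) * (\<epsilon> / 2 * 2 ^ n)"
      unfolding abs_mult using b \<omega> by (intro mult_mono) auto
    also have "\<dots> = \<epsilon> / 2 * (2 / 4) ^ n"
      unfolding power_divide by simp
    finally show ?thesis by simp
  qed
  then have "norm (\<Sum>n. b n * \<omega> n) \<le> (\<Sum>n. \<epsilon> / 2 * (1 / 2) ^ n)"
    by (intro norm_suminf_le sums_summable[OF geom]) simp
  then have "\<bar>\<Sum>n. b n * \<omega> n\<bar> \<le> \<epsilon>"
    using sums_unique[OF geom] by simp
  \<comment> \<open>This covers the branch in which the series takes the default value 0.\<close>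
  moreover have "0 \<le> \<epsilon>"
    using order_trans[OF abs_ge_zero \<omega>[of 0]] by simp
  ultimately show ?thesis
    by (simp add: gauss_series_def)
qed

section \<open>Boxes in the sequence space\<close>

lemma std_normal_interval_linear:
  obtains c where "0 < c" "c \<le> 1" "\<And>r. 0 \<le> r \<Longrightarrow> r \<le> 1 \<Longrightarrow> c * r \<le> measure std_normal_distribution {-r..r}"
proof -
  let ?c = "std_normal_density 1"
  have c: "0 < ?c" by (rule normal_density_pos) simp
  have le: "2 * ?c * r \<le> measure std_normal_distribution {-r..r}" if r: "0 \<le> r" "r \<le> 1" for r
  proof -
    \<comment> \<open>On an interval inside \<open>{-1..1}\<close> the density is at least its value
      \<open>?c\<close> at 1.\<close>
    have "ennreal (2 * ?c * r) = (\<integral>\<^sup>+x. ennreal ?c * indicator {-r..r} x \<partial>lborel)"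
      using r c by (simp add: nn_integral_cmult ennreal_mult'[symmetric] mult.commute)
    also have "\<dots> \<le> (\<integral>\<^sup>+x. ennreal (std_normal_density x) * indicator {-r..r} x \<partial>lborel)"
    proof (intro nn_integral_mono)
      fix x :: real
      have "?c \<le> std_normal_density x" if "x \<in> {-r..r}"
      proof -
        have "\<bar>x\<bar> \<le> 1" using that r by auto
        then have "x\<^sup>2 \<le> 1" by (simp add: abs_square_le_1)
        then show ?thesis by (simp add: std_normal_density_def divide_right_mono)
      qed
      then show "ennreal ?c * indicator {-r..r} x \<le> ennreal (std_normal_density x) * indicator {-r..r} x"
        by (simp add: indicator_def ennreal_leI)
    qed
    also have "\<dots> = emeasure std_normal_distribution {-r..r}"
      by (simp add: emeasure_density)
    also have "\<dots> = ennreal (measure std_normal_distribution {-r..r})"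
      by (rule std_normal.emeasure_eq_measure)
    finally show ?thesis by (simp add: ennreal_le_iff)
  qed
  \<comment> \<open>The bound \<open>c \<le> 1\<close>, read off at radius 1, later makes
    \<open>ln (2 / c)\<close> nonnegative.\<close>
  have "2 * ?c \<le> 1"
    using le[of 1] std_normal.prob_le_1[of "{-1..1}"] by linarith
  then show ?thesis
    using c le by (intro that[of "2 * ?c"]) auto
qed

text \<open>Chebyshev's inequality with mean 0 and variance 1. For radii growing geometrically the
  failure probabilities \<open>1 / r\<^sup>2\<close> are summable.\<close>

lemma std_normal_interval_chebyshev:
  assumes "0 < r"
  shows "1 - 1 / r\<^sup>2 \<le> measure std_normal_distribution {-r..r}"
proof -
  have mean: "(\<integral>x. x \<partial>std_normal_distribution) = 0"
    using integral_std_normal_distribution_moment_odd[of 1] by simp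
  have "integrable std_normal_distribution (\<lambda>x. x\<^sup>2)"
    by (rule integrable_std_normal_distribution_moment)
  then have "measure std_normal_distribution {x\<in>space std_normal_distribution. r \<le> \<bar>x - 0\<bar>} \<le> 1 / r\<^sup>2"
    using std_normal.Chebyshev_inequality[of "\<lambda>x. x" r] assms mean
      std_normal_distribution_even_moments(1)[of 1] by simp
  moreover have "1 - measure std_normal_distribution {x\<in>space std_normal_distribution. r \<le> \<bar>x - 0\<bar>}
      = measure std_normal_distribution (space std_normal_distribution - {x\<in>space std_normal_distribution. r \<le> \<bar>x - 0\<bar>})"
    by (rule std_normal.prob_compl[symmetric]) simp
  moreover have "\<dots> \<le> measure std_normal_distribution {-r..r}"
    by (rule std_normal.finite_measure_mono) auto
  ultimately show ?thesis by linarith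
qed

section \<open>Lower bounds for the probability of a box\<close>

lemma sets_normal_seq_box [measurable]: "{\<omega>. \<forall>n. \<bar>\<omega> n\<bar> \<le> r n} \<in> sets normal_seq"
proof -
  have "{\<omega>\<in>space normal_seq. \<forall>n. \<bar>\<omega> n\<bar> \<le> r n} \<in> sets normal_seq" by measurable
  then show ?thesis by simp
qed

text \<open>The box is the decreasing intersection of the cylinders on the first \<open>N\<close>
  coordinates, whose probabilities are finite products; a bound valid for all
  \<open>N \<ge> K\<close> survives the limit.\<close>

lemma normal_seq_box_ge:
  assumes "\<And>j. a \<le> (\<Prod>n<K + j. measure std_normal_distribution {- r n..r n})"
  shows "a \<le> measure normal_seq {\<omega>. \<forall>n. \<bar>\<omega> n\<bar> \<le> r n}"
proof -
  define A where "A N = {\<omega>\<in>space normal_seq. \<forall>n\<in>{..<N}. \<omega> n \<in> {- r n..r n}}" for N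
  have A: "measure normal_seq (A N) = (\<Prod>n<N. measure std_normal_distribution {- r n..r n})" for N
  proof -
    have "emeasure normal_seq (A N) = (\<Prod>n<N. emeasure std_normal_distribution {- r n..r n})"
      unfolding A_def normal_seq_def by (rule std_normals.emeasure_PiM_Collect) auto
    then have "ennreal (measure normal_seq (A N)) = ennreal (\<Prod>n<N. measure std_normal_distribution {- r n..r n})"
      by (simp add: normal_seq.emeasure_eq_measure std_normal.emeasure_eq_measure prod_ennreal)
    then show ?thesis by (simp add: prod_nonneg)
  qed
  have "(\<lambda>N. measure normal_seq (A N)) \<longlonglongrightarrow> measure normal_seq (\<Inter>N. A N)"
  proof (rule normal_seq.finite_Lim_measure_decseq)
    show "range A \<subseteq> sets normal_seq" unfolding A_def by (auto simp del: space_normal_seq)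
    show "decseq A" by (auto simp: decseq_def A_def)
  qed
  moreover have "(\<Inter>N. A N) = {\<omega>. \<forall>n. \<bar>\<omega> n\<bar> \<le> r n}"
    by (auto simp: A_def abs_le_iff minus_le_iff)
  ultimately have "(\<lambda>N. measure normal_seq (A N)) \<longlonglongrightarrow> measure normal_seq {\<omega>. \<forall>n. \<bar>\<omega> n\<bar> \<le> r n}"
    by simp
  moreover have "a \<le> measure normal_seq (A N)" if "K \<le> N" for N
    using assms[of "N - K"] that by (simp add: A)
  ultimately show ?thesis
    by (intro LIMSEQ_le_const[where a=a]) auto
qed

text \<open>\<open>2 / 3 + (1 / 3) * (1 / 4) ^ j\<close> is \<open>1 - (\<Sum>i=1..j. (1 / 4) ^ i)\<close>, the Chebyshev bound for the
  \<open>j\<close> factors beyond \<open>K\<close>.\<close>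

lemma prod_std_normal_geometric_ge:
  fixes c \<epsilon> :: real
  assumes c: "0 < c" "\<And>r. 0 \<le> r \<Longrightarrow> r \<le> 1 \<Longrightarrow> c * r \<le> measure std_normal_distribution {-r..r}"
    and \<epsilon>: "0 < \<epsilon>" "\<epsilon> \<le> 1" "4 / \<epsilon> \<le> 2 ^ K"
  shows "(c * \<epsilon> / 2) ^ K * (2 / 3 + (1 / 3) * (1 / 4) ^ j)
    \<le> (\<Prod>n<K + j. measure std_normal_distribution {- (\<epsilon> / 2 * 2 ^ n)..\<epsilon> / 2 * 2 ^ n})"
proof (induction j)
  case 0
  \<comment> \<open>The narrowest interval, that of \<open>n = 0\<close>, bounds each of the first
    \<open>K\<close> factors from below.\<close>
  have "c * \<epsilon> / 2 \<le> measure std_normal_distribution {- (\<epsilon> / 2 * 2 ^ n)..\<epsilon> / 2 * 2 ^ n}" for n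
  proof -
    have "c * (\<epsilon> / 2) \<le> measure std_normal_distribution {- (\<epsilon> / 2)..\<epsilon> / 2}"
      using \<epsilon> by (intro c) auto
    also have "\<dots> \<le> measure std_normal_distribution {- (\<epsilon> / 2 * 2 ^ n)..\<epsilon> / 2 * 2 ^ n}"
    proof (intro std_normal.finite_measure_mono)
      have "\<epsilon> / 2 * 1 \<le> \<epsilon> / 2 * 2 ^ n" using \<epsilon> by (intro mult_left_mono) auto
      then show "{- (\<epsilon> / 2)..\<epsilon> / 2} \<subseteq> {- (\<epsilon> / 2 * 2 ^ n)..\<epsilon> / 2 * 2 ^ n}" by auto
    qed simp
    finally show ?thesis by simp
  qed
  then have "(\<Prod>n<K. c * \<epsilon> / 2) \<le> (\<Prod>n<K. measure std_normal_distribution {- (\<epsilon> / 2 * 2 ^ n)..\<epsilon> / 2 * 2 ^ n})"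
    using c \<epsilon> by (intro prod_mono) auto
  then show ?case by simp
next
  case (Suc j)
  let ?y = "(1 / 4) ^ j :: real" and ?r = "\<epsilon> / 2 * 2 ^ (K + j)"
  have y: "0 < ?y" "?y \<le> 1" by (simp_all add: power_le_one)
  \<comment> \<open>By the choice of \<open>K\<close> the radius at index \<open>K + j\<close> is at
    least \<open>2 ^ (j + 1)\<close>, so its failure probability is at most
    \<open>(1 / 4) ^ (j + 1)\<close>.\<close>
  have "2 \<le> \<epsilon> / 2 * 2 ^ K" using \<epsilon> by (simp add: field_simps)
  then have "2 * 2 ^ j \<le> \<epsilon> / 2 * 2 ^ K * 2 ^ j" by (intro mult_right_mono) auto
  then have r: "2 * 2 ^ j \<le> ?r" by (simp add: power_add)
  have "4 * 4 ^ j = (2 * 2 ^ j :: real)\<^sup>2"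
    by (simp add: power2_eq_square flip: power_mult_distrib)
  also have "\<dots> \<le> ?r\<^sup>2" using r by (intro power_mono) auto
  finally have "1 / ?r\<^sup>2 \<le> 1 / (4 * 4 ^ j)"
    by (intro divide_left_mono) (use \<epsilon> in auto)
  also have "\<dots> = ?y / 4" by (simp add: power_one_over)
  finally have "1 - ?y / 4 \<le> 1 - 1 / ?r\<^sup>2" by simp
  also have "\<dots> \<le> measure std_normal_distribution {-?r..?r}"
    using \<epsilon> by (intro std_normal_interval_chebyshev) simp
  finally have f: "1 - ?y / 4 \<le> measure std_normal_distribution {-?r..?r}" .
  \<comment> \<open>Replacing the square by \<open>?y\<close> in the expanded product leaves exactly
    \<open>2 / 3 + ?y / 12\<close>, the next term of the invariant.\<close>
  have "?y * ?y \<le> ?y * 1" using y by (intro mult_left_mono) auto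
  then have "2 / 3 + (1 / 3) * (?y / 4) \<le> (2 / 3 + (1 / 3) * ?y) * (1 - ?y / 4)"
    unfolding ring_distribs by linarith
  then have "2 / 3 + (1 / 3) * (1 / 4) ^ Suc j \<le> (2 / 3 + (1 / 3) * ?y) * (1 - ?y / 4)"
    by simp
  then have "(c * \<epsilon> / 2) ^ K * (2 / 3 + (1 / 3) * (1 / 4) ^ Suc j)
      \<le> (c * \<epsilon> / 2) ^ K * (2 / 3 + (1 / 3) * ?y) * (1 - ?y / 4)"
    using c \<epsilon> unfolding mult.assoc[of "(c * \<epsilon> / 2) ^ K"] by (intro mult_left_mono) auto
  also have "\<dots> \<le> (\<Prod>n<K + j. measure std_normal_distribution {- (\<epsilon> / 2 * 2 ^ n)..\<epsilon> / 2 * 2 ^ n})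
      * measure std_normal_distribution {-?r..?r}"
    using Suc f y by (intro mult_mono prod_nonneg) auto
  finally show ?case by simp
qed

text \<open>About \<open>log 2 (4 / \<epsilon>)\<close> coordinates cost a factor
  \<open>c * \<epsilon> / 2\<close> each and the others together at most a factor
  \<open>2 / 3\<close>, so the logarithm is of order \<open>(ln (1 / \<epsilon>))\<^sup>2\<close>.
  The range of \<open>\<epsilon>\<close> gives \<open>ln (1 / \<epsilon>) \<ge> 1\<close>, which
  absorbs additive constants.\<close>

lemma normal_seq_geometric_box_ge:
  obtains C where "\<And>\<epsilon>. 0 < \<epsilon> \<Longrightarrow> \<epsilon> \<le> exp (- 1) \<Longrightarrow>
    exp (- C * (ln (1 / \<epsilon>))\<^sup>2) \<le> measure normal_seq {\<omega>. \<forall>n. \<bar>\<omega> n\<bar> \<le> \<epsilon> / 2 * 2 ^ n}"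
proof -
  obtain c where c: "0 < c" "c \<le> 1"
    "\<And>r. 0 \<le> r \<Longrightarrow> r \<le> 1 \<Longrightarrow> c * r \<le> measure std_normal_distribution {-r..r}"
    by (rule std_normal_interval_linear) blast
  \<comment> \<open>\<open>A\<close> bounds the number \<open>K\<close> of costly coordinates by
    \<open>A * L\<close>; in \<open>C\<close> it is multiplied by a bound for the cost of one
    coordinate relative to \<open>L\<close>, and \<open>ln (3 / 2)\<close> pays for the factor
    \<open>2 / 3\<close>.\<close>
  define A where "A = (1 + ln 4) / ln 2 + (1::real)"
  define C where "C = ln (3 / 2) + A * (1 + ln (2 / c))"
  have "exp (- C * (ln (1 / \<epsilon>))\<^sup>2) \<le> measure normal_seq {\<omega>. \<forall>n. \<bar>\<omega> n\<bar> \<le> \<epsilon> / 2 * 2 ^ n}"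
    if \<epsilon>: "0 < \<epsilon>" "\<epsilon> \<le> exp (- 1)" for \<epsilon>
  proof -
    define L where "L = ln (1 / \<epsilon>)"
    have "ln \<epsilon> \<le> - 1" using \<epsilon> by (metis ln_exp ln_le_cancel_iff exp_gt_zero)
    then have L: "1 \<le> L" using \<epsilon> by (simp add: L_def ln_div)
    have \<epsilon>1: "\<epsilon> \<le> 1" using \<epsilon> by (meson exp_le_one_iff order_trans neg_le_0_iff_le zero_le_one)
    \<comment> \<open>\<open>z\<close> solves \<open>2 powr z = 4 / \<epsilon>\<close>, and
      \<open>K\<close> is \<open>z\<close> rounded up.\<close>
    define z where "z = (L + ln 4) / ln 2"
    define K where "K = nat \<lceil>z\<rceil>"
    have "0 \<le> z" using L by (simp add: z_def)
    then have K: "z \<le> K" "K \<le> z + 1" unfolding K_def by linarith+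
    have "L + ln 4 \<le> K * ln 2" using K(1) by (simp add: z_def field_simps)
    then have "exp (L + ln 4) \<le> exp (K * ln 2)" by simp
    then have K2: "4 / \<epsilon> \<le> 2 ^ K" using \<epsilon> by (simp add: L_def exp_add exp_of_nat_mult)
    have "z \<le> (L + ln 4 * L) / ln 2"
      unfolding z_def using L mult_left_mono[OF L, of "ln 4"] by (intro divide_right_mono) auto
    then have "z + 1 \<le> A * L" using L by (simp add: A_def algebra_simps add_divide_distrib)
    with K have KA: "K \<le> A * L" by simp
    have lnc: "0 \<le> ln (2 / c)" using c by (intro ln_ge_zero) (simp add: field_simps)
    then have "L + ln (2 / c) \<le> L + ln (2 / c) * L" using mult_left_mono[OF L lnc] by simp
    then have "K * (L + ln (2 / c)) \<le> (A * L) * (L + ln (2 / c) * L)"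
      using KA L lnc by (intro mult_mono) auto
    moreover have CL: "- C * L\<^sup>2 = - (ln (3 / 2) * L\<^sup>2) - (A * L) * (L + ln (2 / c) * L)"
      by (simp add: C_def algebra_simps power2_eq_square)
    moreover have "ln (3 / 2) * 1 \<le> ln (3 / 2) * L\<^sup>2"
      using L by (intro mult_left_mono) auto
    ultimately have "- C * L\<^sup>2 \<le> - ln (3 / 2) - K * (L + ln (2 / c))"
      unfolding CL by linarith
    also have "\<dots> = ln (2 / 3) + K * ln (c * \<epsilon> / 2)"
      using c \<epsilon> by (simp add: L_def ln_div ln_mult algebra_simps)
    also have "\<dots> = ln ((c * \<epsilon> / 2) ^ K * (2 / 3))"
      using c \<epsilon> by (subst ln_mult) (auto simp: ln_realpow)
    finally have "exp (- C * L\<^sup>2) \<le> exp (ln ((c * \<epsilon> / 2) ^ K * (2 / 3)))"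
      by simp
    also have "\<dots> = (c * \<epsilon> / 2) ^ K * (2 / 3)"
      using c \<epsilon> by (subst exp_ln) auto
    also have "\<dots> \<le> measure normal_seq {\<omega>. \<forall>n. \<bar>\<omega> n\<bar> \<le> \<epsilon> / 2 * 2 ^ n}"
    proof (rule normal_seq_box_ge[where K=K])
      fix j
      have "(c * \<epsilon> / 2) ^ K * (2 / 3) \<le> (c * \<epsilon> / 2) ^ K * (2 / 3 + (1 / 3) * (1 / 4) ^ j)"
        using c \<epsilon> by (intro mult_left_mono) auto
      also note prod_std_normal_geometric_ge[OF c(1,3) \<epsilon>(1) \<epsilon>1 K2, of j]
      finally show "(c * \<epsilon> / 2) ^ K * (2 / 3)
        \<le> (\<Prod>n<K + j. measure std_normal_distribution {- (\<epsilon> / 2 * 2 ^ n)..\<epsilon> / 2 * 2 ^ n})" .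
    qed
    finally show ?thesis unfolding L_def .
  qed
  then show ?thesis by (rule that)
qed

section \<open>Entropy of lacunary cosines\<close>

lemma abs_cos_diff_le: "\<bar>cos a - cos b\<bar> \<le> \<bar>a - b\<bar>" for a b :: real
proof -
  have "\<bar>cos a - cos b\<bar> = 2 * \<bar>sin ((a + b) / 2)\<bar> * \<bar>sin ((b - a) / 2)\<bar>"
    by (simp add: cos_diff_cos abs_mult)
  also have "\<dots> \<le> 2 * 1 * \<bar>(b - a) / 2\<bar>"
    by (intro mult_mono abs_sin_x_le_abs_x) auto
  finally show ?thesis by simp
qed

lemma cos_attains_on_period:
  fixes y u l :: real
  assumes "\<bar>y\<bar> \<le> 1" "0 < l"
  obtains t where "u \<le> t" "t \<le> u + 2 * pi / l" "cos (l * t) = y"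
proof
  \<comment> \<open>The least shift of \<open>arccos y\<close> by a multiple of
    \<open>2 * pi\<close> that is not to the left of \<open>l * u\<close>.\<close>
  let ?k = "\<lceil>(l * u - arccos y) / (2 * pi)\<rceil>"
  have two_pi: "0 < 2 * pi" by simp
  let ?t = "(arccos y + of_int ?k * (2 * pi)) / l"
  have "(l * u - arccos y) / (2 * pi) \<le> of_int ?k" by (rule le_of_int_ceiling)
  then have lower: "l * u - arccos y \<le> of_int ?k * (2 * pi)"
    by (simp only: pos_divide_le_eq[OF two_pi])
  have "of_int ?k - 1 \<le> (l * u - arccos y) / (2 * pi)" by linarith
  then have "(of_int ?k - 1) * (2 * pi) \<le> l * u - arccos y"
    by (simp only: pos_le_divide_eq[OF two_pi])
  then have upper: "of_int ?k * (2 * pi) \<le> l * u - arccos y + 2 * pi"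
    by (simp add: algebra_simps)
  have "l * u \<le> arccos y + of_int ?k * (2 * pi)"
    "arccos y + of_int ?k * (2 * pi) \<le> (u + 2 * pi / l) * l"
    using lower upper assms(2) by (simp_all add: algebra_simps)
  then show "u \<le> ?t" "?t \<le> u + 2 * pi / l"
    using assms(2) by (simp_all only: pos_le_divide_eq pos_divide_le_eq mult.commute[of l])
  have "cos (l * ?t) = cos (arccos y + of_int ?k * (2 * pi))"
    using assms(2) by simp
  also have "\<dots> = cos (arccos y)"
    using cos.plus_of_int[of "arccos y" ?k] by (simp add: mult.commute)
  also have "\<dots> = y"
    using assms(1) by (simp add: abs_le_iff)
  finally show "cos (l * ?t) = y" .
qed

text \<open>The interval of stage \<open>m\<close> has room for two periods of \<open>cos (m! * s)\<close>: the target value is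
  attained in the first one, and the next interval starts there and is at most one period long.\<close>

lemma cos_fact_simultaneous_approx:
  fixes x :: "nat \<Rightarrow> real" and k0 m :: nat
  assumes k0: "4 \<le> k0" "4 * pi / (k0 + 1) \<le> \<delta>" and x: "\<And>k. \<bar>x k\<bar> \<le> 1"
  obtains t where "t \<in> {0..1}" "\<And>k. k0 \<le> k \<Longrightarrow> k < m \<Longrightarrow> \<bar>cos (fact k * t) - x k\<bar> \<le> \<delta>"
proof -
  \<comment> \<open>The invariant keeps a whole interval on which all earlier targets are met, so
    that any later choice inside it is safe.\<close>
  have "\<exists>u\<ge>0. u + 4 * pi / fact m \<le> 1 \<and>
      (\<forall>s\<in>{u..u + 4 * pi / fact m}. \<forall>k\<in>{k0..<m}. \<bar>cos (fact k * s) - x k\<bar> \<le> \<delta>)" if "k0 \<le> m" for m :: nat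
    using that
  proof (induction m rule: dec_induct)
    case base
    \<comment> \<open>Here \<open>4 \<le> k0\<close> enters: \<open>4 * pi < 16 < 4!\<close>, so the
      first interval fits into \<open>{0..1}\<close>.\<close>
    have "(24::real) = fact 4" by (simp add: fact_numeral)
    also have "\<dots> \<le> fact k0" by (rule fact_mono) (rule k0)
    finally have "4 * pi \<le> fact k0" using pi_less_4 by linarith
    then have "4 * pi / fact k0 \<le> 1" by simp
    then show ?case by (intro exI[of _ 0]) auto
  next
    case (step m)
    then obtain u where u: "0 \<le> u" "u + 4 * pi / fact m \<le> 1"
      and approx: "\<And>s k. s \<in> {u..u + 4 * pi / fact m} \<Longrightarrow> k \<in> {k0..<m} \<Longrightarrow> \<bar>cos (fact k * s) - x k\<bar> \<le> \<delta>"
      by blast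
    obtain t where t: "u \<le> t" "t \<le> u + 2 * pi / fact m" "cos (fact m * t) = x m"
      using cos_attains_on_period[OF x, of "fact m"] by (metis fact_gt_zero)
    \<comment> \<open>The extra factor \<open>m + 1\<close> shortens the interval to at most one
      period of \<open>cos (fact m * s)\<close>, and across it the phase \<open>fact m * s\<close>
      moves by only \<open>4 * pi / (m + 1) \<le> \<delta>\<close>.\<close>
    have len: "4 * pi / fact (Suc m) = 4 * pi / (m + 1) / fact m"
      by (simp add: field_simps)
    have "4 * pi / fact (Suc m) \<le> 2 * pi / fact m"
      unfolding len using step k0 by (intro divide_right_mono) (simp_all add: field_simps)
    with t have sub: "t + 4 * pi / fact (Suc m) \<le> u + 4 * pi / fact m"
      by (simp add: field_simps)
    have "\<bar>cos (fact k * s) - x k\<bar> \<le> \<delta>"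
      if s: "s \<in> {t..t + 4 * pi / fact (Suc m)}" and k: "k \<in> {k0..<Suc m}" for s k
    proof (cases "k = m")
      case True
      have "\<bar>cos (fact m * s) - x m\<bar> \<le> \<bar>fact m * s - fact m * t\<bar>"
        unfolding t(3)[symmetric] by (rule abs_cos_diff_le)
      also have "\<dots> = fact m * (s - t)"
        using s by (simp add: algebra_simps flip: right_diff_distrib)
      also have "\<dots> \<le> fact m * (4 * pi / fact (Suc m))"
        using s by (intro mult_left_mono) auto
      also have "\<dots> = 4 * pi / (m + 1)"
        unfolding len by simp
      also have "\<dots> \<le> 4 * pi / (k0 + 1)"
        using step by (intro divide_left_mono) auto
      finally show ?thesis using k0(2) True by simp
    next
      case False
      with s k t sub show ?thesis by (intro approx) auto
    qed
    with t u sub show ?case by (intro exI[of _ t]) auto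
  qed
  \<comment> \<open>The maximum also admits \<open>m < k0\<close>, where no target is
    imposed.\<close>
  from this[of "max k0 m"] obtain u where u: "0 \<le> u" "u + 4 * pi / fact (max k0 m) \<le> 1"
    and approx: "\<forall>s\<in>{u..u + 4 * pi / fact (max k0 m)}. \<forall>k\<in>{k0..<max k0 m}. \<bar>cos (fact k * s) - x k\<bar> \<le> \<delta>"
    by auto
  have nonneg: "0 \<le> 4 * pi / fact (max k0 m)" by simp
  show ?thesis
  proof (rule that[of u])
    from nonneg u show "u \<in> {0..1}" unfolding atLeastAtMost_iff by linarith
    from nonneg have "u \<in> {u..u + 4 * pi / fact (max k0 m)}" by (simp only: atLeastAtMost_iff) linarith
    with approx show "\<bar>cos (fact k * u) - x k\<bar> \<le> \<delta>" if "k0 \<le> k" "k < m" for k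
      using that by (metis atLeastLessThan_iff less_max_iff_disj)
  qed
qed

section \<open>Counting separated times\<close>

lemma entropy_number_ge_card:
  assumes "\<And>j. j \<in> J \<Longrightarrow> p j \<in> T"
    and sep: "\<And>i j c. i \<in> J \<Longrightarrow> j \<in> J \<Longrightarrow> c \<in> T \<Longrightarrow> d c (p i) < \<epsilon> \<Longrightarrow> d c (p j) < \<epsilon> \<Longrightarrow> i = j"
  shows "enat (card J) \<le> entropy_number T d \<epsilon>"
  unfolding entropy_number_def
proof (rule INF_greatest)
  fix C assume C: "C \<in> {C. finite C \<and> C \<subseteq> T \<and> T \<subseteq> (\<Union>c\<in>C. {t. d c t < \<epsilon>})}"
  then have "\<forall>j\<in>J. \<exists>c. c \<in> C \<and> d c (p j) < \<epsilon>"
    using assms(1) by blast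
  then obtain g where g: "\<And>j. j \<in> J \<Longrightarrow> g j \<in> C \<and> d (g j) (p j) < \<epsilon>"
    by (metis (no_types))
  \<comment> \<open>Pigeonhole: no ball holds two of the points, so assigning to each point the
    centre of a ball containing it is injective.\<close>
  have "inj_on g J"
  proof (rule inj_onI)
    fix i j assume "i \<in> J" "j \<in> J" "g i = g j"
    then show "i = j"
      using g[of i] g[of j] C by (intro sep[of i j "g i"]) auto
  qed
  moreover have "g ` J \<subseteq> C" using g by blast
  ultimately show "enat (card J) \<le> enat (card C)"
    using C card_inj_on_le[of g J C] by simp
qed

lemma eln_ge_ln:
  assumes "ennreal x \<le> y" "0 < x"
  shows "ereal (ln x) \<le> eln y"
proof (cases y)
  case (real z)
  with assms have "x \<le> z" by (simp add: ennreal_le_iff)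
  with real assms show ?thesis by (auto simp: eln_def)
next
  case top
  then show ?thesis by (simp add: eln_def)
qed

text \<open>Each \<open>j\<close> in \<open>{k0..<m} \<rightarrow>\<^sub>E {..<q}\<close> is encoded
  by a time at which \<open>cos (fact k * t)\<close> is close to \<open>j k / q\<close>. A ball of
  radius \<open>\<epsilon>\<close> sees every coordinate \<open>k < m\<close> with error below
  \<open>1 / (4 * q)\<close>, so it determines \<open>j\<close>.\<close>

lemma entropy_number_cos_fact:
  fixes d :: "real \<Rightarrow> real \<Rightarrow> real" and \<epsilon> :: real and q k0 m :: nat
  assumes d: "\<And>n s t. s \<in> {0..1} \<Longrightarrow> t \<in> {0..1} \<Longrightarrow> \<bar>cos (fact n * s) - cos (fact n * t)\<bar> / 4 ^ n \<le> d s t"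
    and q: "0 < q" and k0: "4 \<le> k0" "4 * pi / (k0 + 1) \<le> 1 / (4 * q)"
    and \<epsilon>: "4 * q * \<epsilon> * 4 ^ m \<le> 1"
  shows "enat (q ^ (m - k0)) \<le> entropy_number {0..1} d \<epsilon>"
proof -
  define J where "J = {k0..<m} \<rightarrow>\<^sub>E {..<q}"
  have "\<exists>t. t \<in> {0..1} \<and> (\<forall>k\<in>{k0..<m}. \<bar>cos (fact k * t) - j k / q\<bar> \<le> 1 / (4 * q))" if j: "j \<in> J" for j
  proof -
    \<comment> \<open>The default 0 keeps the targets in \<open>{-1..1}\<close> at every index, as
      the approximation lemma demands.\<close>
    let ?x = "\<lambda>k. if k \<in> {k0..<m} then real (j k) / q else 0"
    have "\<bar>?x k\<bar> \<le> 1" for k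
    proof (cases "k \<in> {k0..<m}")
      case True
      then have "j k < q" using j by (auto simp: J_def PiE_iff)
      then show ?thesis using True by simp
    qed auto
    from cos_fact_simultaneous_approx[of k0 _ ?x, OF k0 this]
    obtain t where t: "t \<in> {0..1}" "\<And>k. k0 \<le> k \<Longrightarrow> k < m \<Longrightarrow> \<bar>cos (fact k * t) - ?x k\<bar> \<le> 1 / (4 * q)"
      by blast
    show ?thesis
    proof (intro exI[of _ t] conjI ballI)
      fix k assume "k \<in> {k0..<m}"
      then show "\<bar>cos (fact k * t) - j k / q\<bar> \<le> 1 / (4 * q)" using t(2)[of k] by simp
    qed (rule t)
  qed
  then obtain p where p: "\<And>j. j \<in> J \<Longrightarrow> p j \<in> {0..1::real}"
    "\<And>j k. j \<in> J \<Longrightarrow> k \<in> {k0..<m} \<Longrightarrow> \<bar>cos (fact k * p j) - j k / q\<bar> \<le> 1 / (4 * q)"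
    by metis
  have "i = j" if ij: "i \<in> J" "j \<in> J" and c: "c \<in> {0..1}" "d c (p i) < \<epsilon>" "d c (p j) < \<epsilon>" for i j c
  proof (rule PiE_ext[OF ij[unfolded J_def]])
    fix k assume k: "k \<in> {k0..<m}"
    have "\<bar>cos (fact k * c) - cos (fact k * p i)\<bar> / 4 ^ k < \<epsilon>" "\<bar>cos (fact k * c) - cos (fact k * p j)\<bar> / 4 ^ k < \<epsilon>"
      using d[of c "p i" k] d[of c "p j" k] c p(1) ij by fastforce+
    then have "\<bar>cos (fact k * c) - cos (fact k * p i)\<bar> < \<epsilon> * 4 ^ k" "\<bar>cos (fact k * c) - cos (fact k * p j)\<bar> < \<epsilon> * 4 ^ k"
      by (simp_all add: field_simps)
    moreover from this(1) have "0 < \<epsilon> * 4 ^ k" by linarith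
    then have "0 < \<epsilon>" by (simp add: zero_less_mult_iff)
    then have "\<epsilon> * 4 ^ k \<le> \<epsilon> * 4 ^ m" using k by (intro mult_left_mono power_increasing) auto
    moreover have "\<epsilon> * 4 ^ m \<le> 1 / (4 * q)" using \<epsilon> q by (simp add: field_simps)
    moreover note p(2)[OF ij(1) k] p(2)[OF ij(2) k]
    moreover have "1 / (4 * real q) * 4 = 1 / q" by simp
    \<comment> \<open>Four errors of at most \<open>1 / (4 * q)\<close>: two strict ones from the
      ball, two from the approximation of the targets.\<close>
    ultimately have "\<bar>real (i k) / q - j k / q\<bar> < 1 / q" by linarith
    moreover have "real (i k) / q - j k / q = (real (i k) - j k) / q" by (rule diff_divide_distrib[symmetric])
    ultimately have "\<bar>real (i k) - j k\<bar> < 1" using q by (simp add: divide_less_cancel)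
    then show "i k = j k" by linarith
  qed
  then have "enat (card J) \<le> entropy_number {0..1} d \<epsilon>"
    using p(1) by (intro entropy_number_ge_card[where p=p]) blast+
  then show ?thesis by (simp add: J_def card_PiE)
qed

text \<open>With \<open>q = 4 ^ p\<close> values in each of about
  \<open>log 4 (1 / \<epsilon>)\<close> coordinates, the entropy number is at least a constant times
  \<open>(1 / \<epsilon>) ^ p\<close>, and \<open>p\<close> is arbitrary.\<close>

lemma entropy_superpolynomial:
  fixes d :: "real \<Rightarrow> real \<Rightarrow> real"
  assumes d: "\<And>n s t. s \<in> {0..1} \<Longrightarrow> t \<in> {0..1} \<Longrightarrow> \<bar>cos (fact n * s) - cos (fact n * t)\<bar> / 4 ^ n \<le> d s t"
  shows "((\<lambda>\<epsilon>. eln (ennreal_of_enat (entropy_number {0..1} d \<epsilon>)) / ereal (ln (1 / \<epsilon>))) \<longlongrightarrow> \<infinity>) (at_right 0)"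
  unfolding tendsto_PInfty
proof
  fix r :: real
  obtain p :: nat where p: "max 0 r + 1 \<le> p" using real_arch_simple by blast
  then have p1: "1 \<le> p" by auto
  define q :: nat where "q = 4 ^ p"
  have q: "1 \<le> q" by (simp add: q_def)
  obtain k :: nat where k: "16 * pi * q \<le> k" using real_arch_simple by blast
  define k0 where "k0 = k + 4"
  have k0: "4 \<le> k0" "4 * pi / (k0 + 1) \<le> 1 / (4 * q)"
    using k q by (simp_all add: k0_def field_simps)
  define B where "B = p * (ln (4 * real q) + (1 + real k0) * ln 4)"
  have Bq: "ln (4 * real q) + (1 + real k0) * ln 4 \<le> B"
    unfolding B_def using p1 q mult_right_mono[of 1 "real p" "ln (4 * real q) + (1 + real k0) * ln 4"] by simp
  have "eventually (\<lambda>\<epsilon>. \<epsilon> \<in> {0<..<exp (- B)}) (at_right (0::real))"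
    by (rule eventually_at_right_real) simp
  then show "eventually (\<lambda>\<epsilon>. ereal r < eln (ennreal_of_enat (entropy_number {0..1} d \<epsilon>)) / ereal (ln (1 / \<epsilon>))) (at_right 0)"
  proof eventually_elim
    case (elim \<epsilon>)
    define L where "L = ln (1 / \<epsilon>)"
    have \<epsilon>: "0 < \<epsilon>" using elim by simp
    have "ln \<epsilon> < - B" using elim by (metis greaterThanLessThan_iff ln_exp ln_less_cancel_iff exp_gt_zero)
    then have L: "B < L" using \<epsilon> by (simp add: L_def ln_div)
    have ln4: "0 < ln (4::real)" "0 \<le> ln (4 * real q)" using q by simp_all
    then have "0 \<le> (1 + real k0) * ln (4::real)" by simp
    with ln4 Bq L have L0: "0 < L" "ln (4 * real q) \<le> L" by linarith+
    \<comment> \<open>\<open>z\<close> solves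
      \<open>4 * q * \<epsilon> * 4 powr z = 1\<close>.\<close>
    define z where "z = (L - ln (4 * real q)) / ln 4"
    define m where "m = nat \<lfloor>z\<rfloor>"
    have "0 \<le> z" using L0 ln4 by (simp add: z_def)
    then have m: "m \<le> z" "z \<le> m + 1" unfolding m_def by linarith+
    have "m * ln 4 \<le> L - ln (4 * real q)"
      using m(1) ln4 by (simp add: z_def field_simps)
    then have "exp (m * ln 4) \<le> exp (L - ln (4 * real q))" by simp
    then have "4 ^ m \<le> 1 / \<epsilon> / (4 * q)"
      using \<epsilon> q by (simp add: L_def exp_diff exp_of_nat_mult)
    then have "4 * q * \<epsilon> * 4 ^ m \<le> 1" using \<epsilon> q by (simp add: field_simps)
    from entropy_number_cos_fact[OF d _ k0 this] q
    have "enat (q ^ (m - k0)) \<le> entropy_number {0..1} d \<epsilon>" by simp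
    then have "ennreal_of_enat (enat (q ^ (m - k0))) \<le> ennreal_of_enat (entropy_number {0..1} d \<epsilon>)"
      by (simp only: ennreal_of_enat_le_iff)
    then have "ennreal (real (q ^ (m - k0))) \<le> ennreal_of_enat (entropy_number {0..1} d \<epsilon>)"
      by (simp only: ennreal_of_enat_enat ennreal_of_nat_eq_real_of_nat)
    then have le: "ereal (ln (real (q ^ (m - k0)))) \<le> eln (ennreal_of_enat (entropy_number {0..1} d \<epsilon>))"
      using q by (intro eln_ge_ln) auto
    \<comment> \<open>As \<open>r \<le> p - 1\<close>, one copy of \<open>L\<close> remains to
      outweigh \<open>B\<close>.\<close>
    have "r * L < (real p - 1) * L + (L - B)"
      using p L0(1) L mult_right_mono[of r "real p - 1" L] by linarith
    also have "\<dots> = p * (L - ln (4 * real q) - (1 + real k0) * ln 4)"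
      by (simp add: B_def algebra_simps)
    also have "\<dots> = p * (z - 1 - k0) * ln 4"
      using ln4 by (simp add: z_def field_simps)
    \<comment> \<open>Truncated subtraction can only increase the right-hand side.\<close>
    also have "\<dots> \<le> p * real (m - k0) * ln 4"
      using m(2) ln4 by (intro mult_right_mono mult_left_mono) auto
    also have "\<dots> = ln (real (q ^ (m - k0)))"
      by (simp add: q_def ln_realpow)
    finally have "r < ln (real (q ^ (m - k0))) / L" using L0 by (simp add: field_simps)
    then have "ereal r < ereal (ln (real (q ^ (m - k0)))) / ereal L" using L0 by simp
    also have "\<dots> \<le> eln (ennreal_of_enat (entropy_number {0..1} d \<epsilon>)) / ereal L"
      using le L0 by (intro ereal_divide_right_mono) auto
    finally show ?case by (simp add: L_def)
  qed
qed

section \<open>The process\<close>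

definition cos_series :: "real \<Rightarrow> (nat \<Rightarrow> real) \<Rightarrow> real" where
  "cos_series t = gauss_series (\<lambda>n. cos (fact n * t) / 4 ^ n)"

lemma cos_coeff_le: "\<bar>cos (fact n * t) / 4 ^ n\<bar> \<le> 1 / 4 ^ n" for t :: real
  by (simp add: divide_right_mono)

lemma measurable_cos_series [measurable]: "cos_series t \<in> borel_measurable normal_seq"
  unfolding cos_series_def by measurable

lemma centered_gaussian_cos_series: "centered_gaussian_process normal_seq T cos_series"
  unfolding centered_gaussian_process_def gaussian_process_def
proof (intro conjI allI impI ballI)
  fix F :: "real set" and c :: "real \<Rightarrow> real"
  let ?b = "\<lambda>n. \<Sum>t\<in>F. c t * (cos (fact n * t) / 4 ^ n)"
  have "\<bar>?b n\<bar> \<le> (\<Sum>t\<in>F. \<bar>c t\<bar>) / 4 ^ n" for n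
  proof -
    have "\<bar>?b n\<bar> \<le> (\<Sum>t\<in>F. \<bar>c t\<bar> * (1 / 4 ^ n))"
      using cos_coeff_le by (intro order_trans[OF sum_abs] sum_mono) (simp only: abs_mult mult_left_mono abs_ge_zero)
    then show ?thesis by (simp add: sum_divide_distrib)
  qed
  then have "gaussian_variable normal_seq (gauss_series ?b)"
    by (rule gaussian_variable_gauss_series)
  moreover have "(\<Sum>t\<in>F. c t * cos_series t \<omega>) = gauss_series ?b \<omega>" for \<omega>
    unfolding cos_series_def by (rule gauss_series_sum[OF cos_coeff_le])
  ultimately show "gaussian_variable normal_seq (\<lambda>\<omega>. \<Sum>t\<in>F. c t * cos_series t \<omega>)"
    by simp
next
  fix t show "(\<integral>\<omega>. cos_series t \<omega> \<partial>normal_seq) = 0"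
    unfolding cos_series_def by (rule expectation_gauss_series[OF cos_coeff_le])
qed

text \<open>Weierstrass M-test: the series in \<open>good_seq\<close> is a majorant uniform in
  \<open>t\<close>. On bad sequences the path is constantly 0.\<close>

lemma continuous_on_cos_series: "continuous_on T (\<lambda>t. cos_series t \<omega>)"
proof (cases "good_seq \<omega>")
  case True
  have "uniform_limit T (\<lambda>N t. \<Sum>n<N. cos (fact n * t) / 4 ^ n * \<omega> n)
      (\<lambda>t. \<Sum>n. cos (fact n * t) / 4 ^ n * \<omega> n) sequentially"
  proof (rule Weierstrass_m_test)
    show "summable (\<lambda>n. \<bar>\<omega> n\<bar> / 4 ^ n)" using True by (simp add: good_seq_def)
    show "norm (cos (fact n * t) / 4 ^ n * \<omega> n) \<le> \<bar>\<omega> n\<bar> / 4 ^ n" for n t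
      using mult_right_mono[OF cos_coeff_le, of "\<bar>\<omega> n\<bar>" n t] by (simp add: abs_mult)
  qed
  then have "continuous_on T (\<lambda>t. \<Sum>n. cos (fact n * t) / 4 ^ n * \<omega> n)"
    by (rule uniform_limit_theorem[rotated]) (auto intro!: always_eventually continuous_intros)
  with True show ?thesis
    by (simp add: cos_series_def gauss_series_def)
qed (simp add: cos_series_def gauss_series_def)

text \<open>The second moment is a sum of squares, of which a single term is kept. This one bound
  yields both the separation of times and aperiodicity.\<close>

lemma second_moment_cos_series_diff:
  "((cos (fact n * s) - cos (fact n * t)) / 4 ^ n)\<^sup>2 \<le> (\<integral>\<omega>. (cos_series s \<omega> - cos_series t \<omega>)\<^sup>2 \<partial>normal_seq)"
proof -
  let ?b = "\<lambda>n. cos (fact n * s) / 4 ^ n - cos (fact n * t) / 4 ^ n"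
  have b: "\<bar>?b n\<bar> \<le> 2 / 4 ^ n" for n
    using cos_coeff_le[of n s] cos_coeff_le[of n t] by linarith
  have "(?b n)\<^sup>2 = (\<Sum>n\<in>{n}. (?b n)\<^sup>2)" by simp
  also have "\<dots> \<le> (\<Sum>n. (?b n)\<^sup>2)"
    by (intro sum_le_suminf summable_square_coeff[OF b]) auto
  also have "\<dots> = (\<integral>\<omega>. (cos_series s \<omega> - cos_series t \<omega>)\<^sup>2 \<partial>normal_seq)"
    unfolding cos_series_def gauss_series_diff[OF cos_coeff_le cos_coeff_le]
    by (rule second_moment_gauss_series[OF b, symmetric])
  finally show ?thesis by (simp add: diff_divide_distrib)
qed

lemma process_dist_cos_series_ge:
  "\<bar>cos (fact n * s) - cos (fact n * t)\<bar> / 4 ^ n \<le> process_dist normal_seq cos_series s t"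
  using real_sqrt_le_mono[OF second_moment_cos_series_diff[of n s t]]
  by (simp add: process_dist_def real_sqrt_divide)

lemma not_periodic_cos_series: "\<not> periodic_process normal_seq {0..1} cos_series"
proof
  assume "periodic_process normal_seq {0..1} cos_series"
  then obtain p t where p: "0 < p" and t: "t \<in> {0..1}" "t + p \<in> {0..1}"
    and AE: "AE \<omega> in normal_seq. cos_series (t + p) \<omega> = cos_series t \<omega>"
    unfolding periodic_process_def by blast
  \<comment> \<open>Already one pair of almost surely equal values is contradictory: it makes the
    increment variance vanish, hence its term \<open>n = 0\<close>.\<close>
  have "(\<integral>\<omega>. (cos_series (t + p) \<omega> - cos_series t \<omega>)\<^sup>2 \<partial>normal_seq) = 0"
    using AE by (intro integral_eq_zero_AE) auto
  with second_moment_cos_series_diff[of 0 "t + p" t] have eq: "cos (t + p) = cos t"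
    by simp
  have "0 \<le> t" "t \<le> pi" "0 \<le> t + p" "t + p \<le> pi"
    using t pi_gt3 unfolding atLeastAtMost_iff by linarith+
  with eq have "t + p = t"
    using cos_inj_pi by blast
  with p show False by simp
qed

section \<open>The small ball event\<close>

lemma closure_unit_interval_Rats: "closure ({0..1} \<inter> \<rat>) = {0..1::real}"
  using closure_convex_Int_superset[of "{0..1::real}" \<rat>]
  by (simp add: Rats_closure_real)

text \<open>Path continuity reduces the supremum to countably many times, which makes the small ball
  event measurable.\<close>

lemma sup_cos_series_le_iff:
  "(SUP t\<in>{0..1}. \<bar>cos_series t \<omega>\<bar>) \<le> \<epsilon> \<longleftrightarrow> (\<forall>t\<in>{0..1} \<inter> \<rat>. \<bar>cos_series t \<omega>\<bar> \<le> \<epsilon>)"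
proof
  have cont: "continuous_on {0..1} (\<lambda>t. \<bar>cos_series t \<omega>\<bar>)"
    by (intro continuous_on_rabs continuous_on_cos_series)
  \<comment> \<open>A \<open>SUP\<close> over the reals is an upper bound only for a bounded set;
    compactness of \<open>{0..1}\<close> supplies this.\<close>
  then have bdd: "bdd_above ((\<lambda>t. \<bar>cos_series t \<omega>\<bar>) ` {0..1})"
    by (intro bounded_imp_bdd_above compact_imp_bounded compact_continuous_image) auto
  show "\<forall>t\<in>{0..1} \<inter> \<rat>. \<bar>cos_series t \<omega>\<bar> \<le> \<epsilon>" if "(SUP t\<in>{0..1}. \<bar>cos_series t \<omega>\<bar>) \<le> \<epsilon>"
    using that by (blast intro: order_trans[OF cSUP_upper[OF _ bdd]])
  show "(SUP t\<in>{0..1}. \<bar>cos_series t \<omega>\<bar>) \<le> \<epsilon>" if "\<forall>t\<in>{0..1} \<inter> \<rat>. \<bar>cos_series t \<omega>\<bar> \<le> \<epsilon>"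
  proof (rule cSUP_least)
    fix t :: real assume "t \<in> {0..1}"
    then show "\<bar>cos_series t \<omega>\<bar> \<le> \<epsilon>"
      using continuous_le_on_closure[of "{0..1} \<inter> \<rat>" "\<lambda>t. \<bar>cos_series t \<omega>\<bar>" t \<epsilon>] cont that
      by (simp only: closure_unit_interval_Rats)
  qed simp
qed

lemma sets_sup_cos_series_le:
  "{\<omega> \<in> space normal_seq. (SUP t\<in>{0..1}. \<bar>cos_series t \<omega>\<bar>) \<le> \<epsilon>} \<in> sets normal_seq"
proof -
  have "countable ({0..1} \<inter> \<rat> :: real set)"
    by (intro countable_Int2 countable_rat)
  then have "{\<omega> \<in> space normal_seq. \<forall>t\<in>{0..1} \<inter> \<rat>. \<bar>cos_series t \<omega>\<bar> \<le> \<epsilon>} \<in> sets normal_seq"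
    by measurable
  then show ?thesis by (simp only: sup_cos_series_le_iff)
qed

text \<open>The event contains the box with sides \<open>\<epsilon> / 2 * 2 ^ n\<close>, whose
  probability is at least \<open>exp (- C * (ln (1 / \<epsilon>))\<^sup>2)\<close>; hence the lower
  limit is at least \<open>- C\<close>.\<close>

lemma small_ball_cos_series:
  "Liminf (at_right 0) (\<lambda>\<epsilon>. eln (emeasure normal_seq {\<omega> \<in> space normal_seq. (SUP t\<in>{0..1}. \<bar>cos_series t \<omega>\<bar>) \<le> \<epsilon>})
     / ereal ((ln (1 / \<epsilon>))\<^sup>2)) > -\<infinity>"
proof -
  obtain C where C: "\<And>\<epsilon>. 0 < \<epsilon> \<Longrightarrow> \<epsilon> \<le> exp (- 1) \<Longrightarrow>
    exp (- C * (ln (1 / \<epsilon>))\<^sup>2) \<le> measure normal_seq {\<omega>. \<forall>n. \<bar>\<omega> n\<bar> \<le> \<epsilon> / 2 * 2 ^ n}"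
    by (rule normal_seq_geometric_box_ge) blast
  have "eventually (\<lambda>\<epsilon>. \<epsilon> \<in> {0<..<exp (- 1)}) (at_right (0::real))"
    by (rule eventually_at_right_real) simp
  then have "eventually (\<lambda>\<epsilon>. ereal (- C) \<le> eln (emeasure normal_seq
      {\<omega> \<in> space normal_seq. (SUP t\<in>{0..1}. \<bar>cos_series t \<omega>\<bar>) \<le> \<epsilon>}) / ereal ((ln (1 / \<epsilon>))\<^sup>2)) (at_right 0)"
  proof eventually_elim
    case (elim \<epsilon>)
    let ?S = "{\<omega> \<in> space normal_seq. (SUP t\<in>{0..1}. \<bar>cos_series t \<omega>\<bar>) \<le> \<epsilon>}"
    have "exp (- C * (ln (1 / \<epsilon>))\<^sup>2) \<le> measure normal_seq {\<omega>. \<forall>n. \<bar>\<omega> n\<bar> \<le> \<epsilon> / 2 * 2 ^ n}"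
      using elim by (intro C) auto
    also have "\<dots> \<le> measure normal_seq ?S"
    proof (intro normal_seq.finite_measure_mono sets_sup_cos_series_le subsetI)
      fix \<omega> :: "nat \<Rightarrow> real" assume "\<omega> \<in> {\<omega>. \<forall>n. \<bar>\<omega> n\<bar> \<le> \<epsilon> / 2 * 2 ^ n}"
      then have "\<bar>cos_series t \<omega>\<bar> \<le> \<epsilon>" for t
        unfolding cos_series_def by (intro abs_gauss_series_le cos_coeff_le) auto
      then show "\<omega> \<in> ?S" by (simp add: cSUP_least)
    qed
    finally have "ennreal (exp (- C * (ln (1 / \<epsilon>))\<^sup>2)) \<le> emeasure normal_seq ?S"
      by (simp add: normal_seq.emeasure_eq_measure ennreal_leI)
    from eln_ge_ln[OF this] have le: "ereal (- C * (ln (1 / \<epsilon>))\<^sup>2) \<le> eln (emeasure normal_seq ?S)"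
      by simp
    \<comment> \<open>Having \<open>\<epsilon> < 1\<close> makes the denominator positive, so the
      division preserves the inequality.\<close>
    have "exp (- 1) < (1::real)" by simp
    with elim have "\<epsilon> < 1" by (simp only: greaterThanLessThan_iff) linarith
    with elim have pos: "0 < (ln (1 / \<epsilon>))\<^sup>2" by (simp add: ln_div)
    then have "ereal (- C) = ereal (- C * (ln (1 / \<epsilon>))\<^sup>2) / ereal ((ln (1 / \<epsilon>))\<^sup>2)" by simp
    also have "\<dots> \<le> eln (emeasure normal_seq ?S) / ereal ((ln (1 / \<epsilon>))\<^sup>2)"
      using le pos by (intro ereal_divide_right_mono) auto
    finally show ?case .
  qed
  then have "ereal (- C) \<le> Liminf (at_right 0) (\<lambda>\<epsilon>. eln (emeasure normal_seq
      {\<omega> \<in> space normal_seq. (SUP t\<in>{0..1}. \<bar>cos_series t \<omega>\<bar>) \<le> \<epsilon>}) / ereal ((ln (1 / \<epsilon>))\<^sup>2))"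
    by (rule Liminf_bounded)
  then show ?thesis by (rule less_le_trans[rotated]) simp
qed

theorem proposition2p6:
  shows "\<exists>(M :: (nat \<Rightarrow> real) measure) (X :: real \<Rightarrow> (nat \<Rightarrow> real) \<Rightarrow> real).
    prob_space M \<and>
    centered_gaussian_process M {0..1} X \<and>
    sample_continuous M {0..1} X \<and>
    \<not> periodic_process M {0..1} X \<and>
    ((\<lambda>\<epsilon>. eln (ennreal_of_enat (entropy_number {0..1} (process_dist M X) \<epsilon>)) / ereal (ln (1 / \<epsilon>)))
       \<longlongrightarrow> \<infinity>) (at_right 0) \<and>
    Liminf (at_right 0) (\<lambda>\<epsilon>. eln (emeasure M {\<omega> \<in> space M. (SUP t\<in>{0..1}. \<bar>X t \<omega>\<bar>) \<le> \<epsilon>})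
       / ereal ((ln (1 / \<epsilon>))\<^sup>2)) > -\<infinity>"
proof (intro exI[of _ normal_seq] exI[of _ cos_series] conjI)
  show "sample_continuous normal_seq {0..1} cos_series"
    by (simp add: sample_continuous_def continuous_on_cos_series)
  show "((\<lambda>\<epsilon>. eln (ennreal_of_enat (entropy_number {0..1} (process_dist normal_seq cos_series) \<epsilon>))
      / ereal (ln (1 / \<epsilon>))) \<longlongrightarrow> \<infinity>) (at_right 0)"
    by (rule entropy_superpolynomial) (rule process_dist_cos_series_ge)
qed (fact prob_space_normal_seq centered_gaussian_cos_series not_periodic_cos_series small_ball_cos_series)+

end
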